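(* Suppose $(G,X,H)$ is an A/QI triple. Then $H$ has finite height in $G$.
   Context: A hyperbolic space is a Gromov hyperbolic geodesic metric space $(X,d)$; all actions are by isometries. $G$ is not assumed finitely generated. For $Y\subseteq X$, an action $G\curvearrowright X$ is acylindrical along $Y$ if for every $\varepsilon\ge 0$ there are $R>0$ and $M>0$ so that, whenever $x,y\in Y$ satisfy $d(x,y)\ge R$, $\#\{g\in G\mid d(gx,x)\le\varepsilon \text{ and } d(gy,y)\le\varepsilon\}\le M$. For $H<G$, the action is acylindrical along $H$ if it is acylindrical along $Hx$ for some (equivalently any) $x\in X$. A finitely generated subgroup $H<G$ is quasi-isometrically embedded by the action if, for some (equivalently any) $x\in X$, $h\mapsto hx$ is a quasi-isometric embedding of $H$ (with a word metric) into $X$. An A/QI triple $(G,X,H)$ consists of a hyperbolic space $X$ and an action $G\curvearrowright X$ which is acylindrical along a finitely generated infinite subgroup $H<G$ that is quasi-isometrically embedded by the action. Height: if $H$ is finite its height is $0$. Otherwise the height of $H$ in $G$ is the largest $n$ such that there are distinct cosets $g_1H,\dots,g_nH$ with $\bigcap_{i=1}^n g_iHg_i^{-1}$ infinite; if there is no largest such $n$, the height is infinite. *)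

theory Defs
  imports
    "HOL-Algebra.Group_Action"
    "HOL-Algebra.Generated_Groups"
    "HOL-Analysis.Abstract_Metric_Spaces"
    "HOL-Library.Extended_Nat"
begin

section \<open>Hyperbolic spaces\<close>

definition geodesic :: "'b set \<Rightarrow> ('b \<Rightarrow> 'b \<Rightarrow> real) \<Rightarrow> (real \<Rightarrow> 'b) \<Rightarrow> 'b \<Rightarrow> 'b \<Rightarrow> bool" where
  "geodesic X d \<gamma> x y \<longleftrightarrow>
     \<gamma> \<in> {0..d x y} \<rightarrow> X \<and> \<gamma> 0 = x \<and> \<gamma> (d x y) = y \<and>
     (\<forall>s\<in>{0..d x y}. \<forall>t\<in>{0..d x y}. d (\<gamma> s) (\<gamma> t) = \<bar>s - t\<bar>)"

text \<open>
  Gromov hyperbolicity of a geodesic space is expressed by slim geodesic triangles: every side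
  lies in the \<open>\<delta>\<close>-neighbourhood of the union of the other two. Since the three sides are
  quantified over all vertices and all geodesics, it suffices to state this for one of them.
\<close>
locale hyperbolic_space = Metric_space X d
  for X :: "'b set" and d :: "'b \<Rightarrow> 'b \<Rightarrow> real" +
  assumes geodesic_exists: "\<And>x y. \<lbrakk>x \<in> X; y \<in> X\<rbrakk> \<Longrightarrow> \<exists>\<gamma>. geodesic X d \<gamma> x y"
    and slim_triangles:
      "\<exists>\<delta>\<ge>0. \<forall>x\<in>X. \<forall>y\<in>X. \<forall>z\<in>X. \<forall>\<alpha> \<beta> \<gamma>.
         geodesic X d \<alpha> x y \<and> geodesic X d \<beta> y z \<and> geodesic X d \<gamma> x z \<longrightarrow>
         (\<forall>p \<in> \<alpha> ` {0..d x y}. \<exists>q \<in> \<beta> ` {0..d y z} \<union> \<gamma> ` {0..d x z}. d p q \<le> \<delta>)"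

locale isometric_action = group_action G X \<phi> + Metric_space X d
  for G :: "('a, 'm) monoid_scheme" (structure) and X :: "'b set"
    and d :: "'b \<Rightarrow> 'b \<Rightarrow> real" and \<phi> :: "'a \<Rightarrow> 'b \<Rightarrow> 'b" +
  assumes isometry: "\<And>g x y. \<lbrakk>g \<in> carrier G; x \<in> X; y \<in> X\<rbrakk> \<Longrightarrow> d (\<phi> g x) (\<phi> g y) = d x y"

section \<open>Word metrics and quasi-isometric embeddings\<close>

text \<open>
  The word length is only meaningful on the subgroup generated by \<open>S\<close>; there the set
  of lengths is nonempty.
\<close>
definition word_length :: "('a, 'm) monoid_scheme \<Rightarrow> 'a set \<Rightarrow> 'a \<Rightarrow> nat" where
  "word_length G S g =
     (LEAST n. \<exists>ws. set ws \<subseteq> S \<union> m_inv G ` S \<and> length ws = n \<and>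
        foldr (\<otimes>\<^bsub>G\<^esub>) ws \<one>\<^bsub>G\<^esub> = g)"

definition word_metric :: "('a, 'm) monoid_scheme \<Rightarrow> 'a set \<Rightarrow> 'a \<Rightarrow> 'a \<Rightarrow> real" where
  "word_metric G S g h = real (word_length G S (inv\<^bsub>G\<^esub> g \<otimes>\<^bsub>G\<^esub> h))"

definition finite_generating_set :: "('a, 'm) monoid_scheme \<Rightarrow> 'a set \<Rightarrow> 'a set \<Rightarrow> bool" where
  "finite_generating_set G H S \<longleftrightarrow> finite S \<and> S \<subseteq> H \<and> generate G S = H"

definition finitely_generated :: "('a, 'm) monoid_scheme \<Rightarrow> 'a set \<Rightarrow> bool" where
  "finitely_generated G H \<longleftrightarrow> (\<exists>S. finite_generating_set G H S)"

definition quasi_isometric_embedding ::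
  "'a set \<Rightarrow> ('a \<Rightarrow> 'a \<Rightarrow> real) \<Rightarrow> 'b set \<Rightarrow> ('b \<Rightarrow> 'b \<Rightarrow> real) \<Rightarrow> ('a \<Rightarrow> 'b) \<Rightarrow> bool" where
  "quasi_isometric_embedding A dA B dB f \<longleftrightarrow>
     f \<in> A \<rightarrow> B \<and>
     (\<exists>K\<ge>1. \<exists>C\<ge>0. \<forall>a\<in>A. \<forall>b\<in>A.
        dA a b / K - C \<le> dB (f a) (f b) \<and> dB (f a) (f b) \<le> K * dA a b + C)"

definition qi_embedded_by_action ::
  "('a, 'm) monoid_scheme \<Rightarrow> 'b set \<Rightarrow> ('b \<Rightarrow> 'b \<Rightarrow> real) \<Rightarrow> ('a \<Rightarrow> 'b \<Rightarrow> 'b) \<Rightarrow> 'a set \<Rightarrow> bool" where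
  "qi_embedded_by_action G X d \<phi> H \<longleftrightarrow>
     (\<exists>S. finite_generating_set G H S \<and>
        (\<exists>x\<in>X. quasi_isometric_embedding H (word_metric G S) X d (\<lambda>h. \<phi> h x)))"

section \<open>Acylindricity along a subset and along a subgroup\<close>

definition acylindrical_along ::
  "('a, 'm) monoid_scheme \<Rightarrow> ('b \<Rightarrow> 'b \<Rightarrow> real) \<Rightarrow> ('a \<Rightarrow> 'b \<Rightarrow> 'b) \<Rightarrow> 'b set \<Rightarrow> bool" where
  "acylindrical_along G d \<phi> Y \<longleftrightarrow>
     (\<forall>\<epsilon>\<ge>0. \<exists>R>0. \<exists>M::nat. M > 0 \<and>
        (\<forall>x\<in>Y. \<forall>y\<in>Y. d x y \<ge> R \<longrightarrow>
           finite {g \<in> carrier G. d (\<phi> g x) x \<le> \<epsilon> \<and> d (\<phi> g y) y \<le> \<epsilon>} \<and>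
           card {g \<in> carrier G. d (\<phi> g x) x \<le> \<epsilon> \<and> d (\<phi> g y) y \<le> \<epsilon>} \<le> M))"

definition acylindrical_along_subgroup ::
  "('a, 'm) monoid_scheme \<Rightarrow> 'b set \<Rightarrow> ('b \<Rightarrow> 'b \<Rightarrow> real) \<Rightarrow> ('a \<Rightarrow> 'b \<Rightarrow> 'b) \<Rightarrow> 'a set \<Rightarrow> bool" where
  "acylindrical_along_subgroup G X d \<phi> H \<longleftrightarrow>
     (\<exists>x\<in>X. acylindrical_along G d \<phi> ((\<lambda>h. \<phi> h x) ` H))"

section \<open>A/QI triples\<close>

locale AQI_triple = hyperbolic_space X d + isometric_action G X d \<phi> + subgroup H G
  for G :: "('a, 'm) monoid_scheme" (structure) and X :: "'b set"
    and d :: "'b \<Rightarrow> 'b \<Rightarrow> real" and \<phi> :: "'a \<Rightarrow> 'b \<Rightarrow> 'b" and H :: "'a set" +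
  assumes finitely_generated: "finitely_generated G H"
    and infinite: "infinite H"
    and qi_embedded: "qi_embedded_by_action G X d \<phi> H"
    and acylindrical: "acylindrical_along_subgroup G X d \<phi> H"

section \<open>Height\<close>

definition infinite_conjugate_intersection ::
  "('a, 'm) monoid_scheme \<Rightarrow> 'a set \<Rightarrow> nat \<Rightarrow> bool" where
  "infinite_conjugate_intersection G H n \<longleftrightarrow>
     (\<exists>g :: nat \<Rightarrow> 'a. (\<forall>i\<in>{1..n}. g i \<in> carrier G) \<and>
        inj_on (\<lambda>i. g i <#\<^bsub>G\<^esub> H) {1..n} \<and>
        infinite (\<Inter>i\<in>{1..n}. g i <#\<^bsub>G\<^esub> H #>\<^bsub>G\<^esub> inv\<^bsub>G\<^esub> (g i)))"

text \<open>
  For infinite \<open>H\<close> the case \<open>n = 1\<close> always occurs, so it does not matter how the empty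
  intersection for \<open>n = 0\<close> is read.
\<close>
definition height :: "('a, 'm) monoid_scheme \<Rightarrow> 'a set \<Rightarrow> enat" where
  "height G H =
     (if finite H then 0
      else if \<exists>n. infinite_conjugate_intersection G H n \<and>
                  (\<forall>m. infinite_conjugate_intersection G H m \<longrightarrow> m \<le> n)
      then enat (GREATEST n. infinite_conjugate_intersection G H n)
      else \<infinity>)"

end

(*
  The orbit map of H is a quasi-isometric embedding, so by the Morse lemma every translate g H x is
  quasi-convex. Let k be an element of the intersection of the conjugates g_i H g_i^-1 that moves a
  base point far compared with the distances between the points g_i x. The geodesics from g_i x to
  k g_i x then run uniformly close to each other away from their ends, so two points p, q in the
  middle, at a prescribed distance, are uniformly close to g_i a_i x and g_i b_i x for some
  a_i, b_i in H. Only boundedly many values of a_i^-1 b_i are possible, since balls in H are finite,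
  and for two indices i, j with the same value the element (g_j a_j)^-1 (g_i a_i) moves two far
  apart points of H x only a bounded amount. Acylindricity bounds the number of such indices.
*)

theory Submission
  imports Defs "HOL-Real_Asymp.Real_Asymp"
begin

section \<open>Metric intervals and slim triangles\<close>

text \<open>The interval between two points of a geodesic space is the union of all geodesics joining
  them; working with it avoids carrying parametrisations along.\<close>

definition (in Metric_space) metric_interval :: "'a \<Rightarrow> 'a \<Rightarrow> 'a set" where
  "metric_interval x y = {u \<in> M. d x u + d u y = d x y}"

text \<open>Slim triangles for all geodesics at once: an interval is the union of the geodesics
  between its ends, so no geodesic has to be chosen.\<close>

definition (in Metric_space) slim :: "real \<Rightarrow> bool" where
  "slim \<delta> \<longleftrightarrow> \<delta> \<ge> 0 \<and> (\<forall>x\<in>M. \<forall>y\<in>M. \<forall>z\<in>M. \<forall>p\<in>metric_interval x y.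
     \<exists>q\<in>metric_interval y z \<union> metric_interval x z. d p q \<le> \<delta>)"

context Metric_space
begin

lemma metric_intervalD:
  assumes "u \<in> metric_interval x y"
  shows "u \<in> M" "d x u + d u y = d x y"
  using assms by (auto simp: metric_interval_def)

lemma metric_interval_commute: "metric_interval x y = metric_interval y x"
  by (auto simp: metric_interval_def commute add.commute)

lemma metric_interval_ends:
  assumes "x \<in> M" "y \<in> M"
  shows "x \<in> metric_interval x y" "y \<in> metric_interval x y"
  using assms by (auto simp: metric_interval_def)

lemma metric_interval_same:
  assumes "x \<in> M" "u \<in> metric_interval x x"
  shows "u = x"
proof -
  have "d x u = 0"
    using assms metric_intervalD[OF assms(2)] nonneg[of x u] nonneg[of u x]
    by (smt (verit) mdist_zero)
  then show ?thesis
    using assms metric_intervalD(1)[OF assms(2)] zero by blast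
qed

text \<open>The lengths from \<open>x\<close> to \<open>p\<close>, from \<open>p\<close> to
  \<open>q\<close> and from \<open>q\<close> to \<open>y\<close> add up to \<open>d x y\<close>, so
  the triangle inequalities through \<open>q\<close> must be equalities.\<close>

lemma metric_interval_trans:
  assumes xy: "x \<in> M" "y \<in> M" and p: "p \<in> metric_interval x y" and q: "q \<in> metric_interval p y"
  shows "q \<in> metric_interval x y" "p \<in> metric_interval x q"
proof -
  note P = metric_intervalD[OF p] and Q = metric_intervalD[OF q]
  have "d x q \<le> d x p + d p q" "d x y \<le> d x q + d q y"
    using triangle P Q xy by auto
  with P Q show "q \<in> metric_interval x y" "p \<in> metric_interval x q"
    by (auto simp: metric_interval_def)
qed

lemma slimE:
  assumes "slim \<delta>" "x \<in> M" "y \<in> M" "z \<in> M" "p \<in> metric_interval x y"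
  obtains q where "q \<in> metric_interval y z \<union> metric_interval x z" "d p q \<le> \<delta>"
  using assms unfolding slim_def by blast

lemma slim_nonneg: "slim \<delta> \<Longrightarrow> \<delta> \<ge> 0"
  by (simp add: slim_def)

text \<open>Cut the quadrilateral along the diagonal from \<open>x\<close> to \<open>y'\<close> and
  use slimness in both triangles. Each time the short side, of length at most \<open>C\<close>, is
  excluded because \<open>p\<close> is too far from \<open>x\<close> and \<open>y\<close>.\<close>

lemma slim_quadrilateral:
  assumes sl: "slim \<delta>" and M: "x \<in> M" "y \<in> M" "x' \<in> M" "y' \<in> M"
    and C: "d x x' \<le> C" "d y y' \<le> C"
    and p: "p \<in> metric_interval x y" "d x p > C + 2 * \<delta>" "d p y > C + 2 * \<delta>"
  shows "\<exists>q\<in>metric_interval x' y'. d p q \<le> 2 * \<delta>"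
proof -
  note P = metric_intervalD[OF p(1)]
  have \<delta>: "\<delta> \<ge> 0" by (rule slim_nonneg[OF sl])
  obtain q where q: "q \<in> metric_interval y y' \<union> metric_interval x y'" "d p q \<le> \<delta>"
    using slimE[OF sl M(1,2,4) p(1)] .
  have "q \<notin> metric_interval y y'"
  proof
    assume "q \<in> metric_interval y y'"
    note Q = metric_intervalD[OF this]
    have "d y q \<le> C" using Q C nonneg[of q y'] by linarith
    moreover have "d p y \<le> d p q + d q y" using triangle P Q M by blast
    ultimately show False using q(2) p(3) \<delta> commute[of q y] by linarith
  qed
  with q have q': "q \<in> metric_interval y' x" by (simp add: metric_interval_commute)
  note Q = metric_intervalD[OF q']
  obtain r where r: "r \<in> metric_interval x x' \<union> metric_interval y' x'" "d q r \<le> \<delta>"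
    using slimE[OF sl M(4,1,3) q'] .
  have rM: "r \<in> M" using r(1) metric_intervalD by auto
  have pr: "d p r \<le> 2 * \<delta>" using triangle[of p q r] P Q rM q r by auto
  have "r \<notin> metric_interval x x'"
  proof
    assume "r \<in> metric_interval x x'"
    note R = metric_intervalD[OF this]
    have "d x r \<le> C" using R C nonneg[of r x'] by linarith
    moreover have "d x p \<le> d x r + d r p" using triangle P R M by blast
    ultimately show False using pr p(2) commute[of r p] by linarith
  qed
  with r pr show ?thesis by (auto simp: metric_interval_commute)
qed

text \<open>Exponential divergence: bisecting a chain of \<open>n\<close> steps costs \<open>\<delta>\<close> each time, so the
  distance to the chain grows only logarithmically in \<open>n\<close>.\<close>

lemma slim_chain:
  assumes sl: "slim \<delta>"
  shows "\<lbrakk>0 < n; n \<le> 2 ^ k; \<And>i. i \<le> n \<Longrightarrow> c i \<in> M; p \<in> metric_interval (c 0) (c n)\<rbrakk>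
    \<Longrightarrow> \<exists>i<n. \<exists>u\<in>metric_interval (c i) (c (Suc i)). d p u \<le> real k * \<delta>"
proof (induction k arbitrary: n c p)
  case 0
  then have "n = 1" by simp
  with 0 show ?case
    by (intro exI[of _ 0] conjI bexI[of _ p]) (auto dest: metric_intervalD)
next
  case (Suc k)
  have \<delta>: "\<delta> \<ge> 0" by (rule slim_nonneg[OF sl])
  show ?case
  proof (cases "n \<le> 2 ^ k")
    case True
    then obtain i u where "i < n" "u \<in> metric_interval (c i) (c (Suc i))" "d p u \<le> real k * \<delta>"
      using Suc.IH[of n c p] Suc.prems by blast
    moreover have "real k * \<delta> \<le> real (Suc k) * \<delta>"
      using \<delta> by (intro mult_right_mono) auto
    ultimately show ?thesis by (meson order_trans)
  next
    case False
    \<comment> \<open>The chain is cut after exactly \<open>2 ^ k\<close> steps; the rest has at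
      most \<open>2 ^ k\<close>, so the induction hypothesis applies to both pieces.\<close>
    define m where "m = (2::nat) ^ k"
    have m: "0 < m" "m < n" "n - m \<le> 2 ^ k"
      using False Suc.prems by (auto simp: m_def)
    have pM: "p \<in> M" using Suc.prems metric_intervalD by auto
    obtain q where q: "q \<in> metric_interval (c n) (c m) \<union> metric_interval (c 0) (c m)" "d p q \<le> \<delta>"
      using slimE[OF sl, of "c 0" "c n" "c m" p] Suc.prems m by (metis le0 le_refl less_imp_le)
    have qM: "q \<in> M" using q metric_intervalD by auto
    have step: "d p u \<le> real (Suc k) * \<delta>" if "d q u \<le> real k * \<delta>" "u \<in> M" for u
      using triangle[of p q u] that q pM qM by (simp add: algebra_simps)
    show ?thesis
    proof (cases "q \<in> metric_interval (c 0) (c m)")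
      case True
      then obtain i u where "i < m" "u \<in> metric_interval (c i) (c (Suc i))" "d q u \<le> real k * \<delta>"
        using Suc.IH[of m c q] Suc.prems m by (auto simp: m_def)
      then show ?thesis
        using step metric_intervalD(1) m by (meson less_trans)
    next
      case False
      with q have "q \<in> metric_interval (c (0 + m)) (c (n - m + m))"
        using m by (simp add: metric_interval_commute)
      then obtain i u where "i < n - m" "u \<in> metric_interval (c (i + m)) (c (Suc i + m))"
          "d q u \<le> real k * \<delta>"
        using Suc.IH[of "n - m" "\<lambda>i. c (i + m)" q] Suc.prems m by auto
      then show ?thesis
        using step[of u] metric_intervalD(1)
        by (intro exI[of _ "i + m"] conjI bexI[of _ u]) auto
    qed
  qed
qed

end

section \<open>Geodesics, intervals and slimness in a hyperbolic space\<close>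

context hyperbolic_space
begin

lemma geodesicD:
  assumes "geodesic X d \<gamma> x y" "0 \<le> t" "t \<le> d x y"
  shows "\<gamma> t \<in> X" "d x (\<gamma> t) = t" "d (\<gamma> t) y = d x y - t"
proof -
  have ends: "\<gamma> 0 = x" "\<gamma> (d x y) = y"
    and iso: "\<And>s t. \<lbrakk>s \<in> {0..d x y}; t \<in> {0..d x y}\<rbrakk> \<Longrightarrow> d (\<gamma> s) (\<gamma> t) = \<bar>s - t\<bar>"
    using assms(1) unfolding geodesic_def by blast+
  show "\<gamma> t \<in> X" using assms by (auto simp: geodesic_def)
  show "d x (\<gamma> t) = t" using iso[of 0 t] ends assms by simp
  show "d (\<gamma> t) y = d x y - t" using iso[of t "d x y"] ends assms by simp
qed

lemma point_at_distance:
  assumes "x \<in> X" "y \<in> X" "0 \<le> t" "t \<le> d x y"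
  obtains u where "u \<in> metric_interval x y" "d x u = t"
proof -
  obtain \<gamma> where "geodesic X d \<gamma> x y" using geodesic_exists assms by blast
  from geodesicD[OF this assms(3,4)] show thesis
    by (intro that[of "\<gamma> t"]) (auto simp: metric_interval_def)
qed

lemma geodesic_image_subset:
  assumes "geodesic X d \<gamma> x y"
  shows "\<gamma> ` {0..d x y} \<subseteq> metric_interval x y"
  using geodesicD[OF assms] by (auto simp: metric_interval_def)

text \<open>A geodesic from \<open>x\<close> to \<open>u\<close> followed by one from
  \<open>u\<close> to \<open>y\<close> is again a geodesic, because the two lengths add up to
  \<open>d x y\<close>.\<close>

lemma geodesic_through:
  assumes xy: "x \<in> X" "y \<in> X" and u: "u \<in> metric_interval x y"
  obtains \<gamma> where "geodesic X d \<gamma> x y" "u \<in> \<gamma> ` {0..d x y}"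
proof -
  note U = metric_intervalD[OF u]
  obtain \<alpha> \<beta> where \<alpha>: "geodesic X d \<alpha> x u" and \<beta>: "geodesic X d \<beta> u y"
    using geodesic_exists xy U by metis
  define a where "a = d x u"
  define \<gamma> where "\<gamma> t = (if t \<le> a then \<alpha> t else \<beta> (t - a))" for t
  have a: "0 \<le> a" "d u y = d x y - a" "d x y \<ge> a"
    using U(2) nonneg[of x u] nonneg[of u y] unfolding a_def by linarith+
  note \<alpha>' = \<alpha>[unfolded geodesic_def a_def[symmetric]]
  note \<beta>' = \<beta>[unfolded geodesic_def a]
  have \<gamma>0: "\<gamma> 0 = x" and \<gamma>a: "\<gamma> a = u"
    using \<alpha>' a by (auto simp: \<gamma>_def)
  have \<gamma>1: "\<gamma> (d x y) = y"
    using \<alpha>' \<beta>' a by (cases "d x y = a") (auto simp: \<gamma>_def)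
  have in_X: "\<gamma> t \<in> X" if "t \<in> {0..d x y}" for t
    using that \<alpha>' \<beta>' a by (auto simp: \<gamma>_def Pi_iff)
  have dist_le: "d (\<gamma> s) (\<gamma> t) \<le> t - s" and dist_ge: "d (\<gamma> s) (\<gamma> t) \<ge> t - s"
    if st: "0 \<le> s" "s \<le> t" "t \<le> d x y" for s t
  proof -
    have *: "d (\<gamma> s) (\<gamma> t) \<le> t - s" if st: "0 \<le> s" "s \<le> t" "t \<le> d x y" for s t
    proof -
      consider "t \<le> a" | "a < s" | "s \<le> a" "a < t" by linarith
      then show ?thesis
      proof cases
        case 1
        then show ?thesis using \<alpha>' st by (auto simp: \<gamma>_def)
      next
        case 2
        then show ?thesis using \<beta>' st by (auto simp: \<gamma>_def)
      next
        case 3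
        have "d (\<gamma> s) u = a - s"
          using geodesicD(3)[OF \<alpha>, of s] 3 st by (simp add: \<gamma>_def a_def)
        moreover have "d u (\<gamma> t) = t - a"
          using geodesicD(2)[OF \<beta>, of "t - a"] 3 st a(2) by (simp add: \<gamma>_def)
        ultimately show ?thesis
          using triangle[of "\<gamma> s" u "\<gamma> t"] in_X[of s] in_X[of t] U st by auto
      qed
    qed
    then show "d (\<gamma> s) (\<gamma> t) \<le> t - s" using st by blast
    \<comment> \<open>The lower bound follows from the upper bound \<open>*\<close> on the two outer
      pieces: a shortcut between \<open>s\<close> and \<open>t\<close> would make the whole path
      shorter than \<open>d x y\<close>.\<close>
    have "d x y \<le> d x (\<gamma> s) + d (\<gamma> s) (\<gamma> t) + d (\<gamma> t) y"
      using triangle[of x "\<gamma> s" y] triangle[of "\<gamma> s" "\<gamma> t" y] in_X[of s] in_X[of t] xy st by auto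
    moreover have "d x (\<gamma> s) \<le> s" "d (\<gamma> t) y \<le> d x y - t"
      using *[of 0 s] *[of t "d x y"] st \<gamma>0 \<gamma>1 by auto
    ultimately show "d (\<gamma> s) (\<gamma> t) \<ge> t - s" by linarith
  qed
  have "d (\<gamma> s) (\<gamma> t) = \<bar>s - t\<bar>" if "s \<in> {0..d x y}" "t \<in> {0..d x y}" for s t
    using dist_le[of s t] dist_ge[of s t] dist_le[of t s] dist_ge[of t s] that commute[of "\<gamma> s" "\<gamma> t"]
    by (cases "s \<le> t") auto
  then have "geodesic X d \<gamma> x y"
    using in_X \<gamma>0 \<gamma>1 by (auto simp: geodesic_def)
  moreover have "u \<in> \<gamma> ` {0..d x y}"
    using \<gamma>a a by (intro image_eqI[of _ _ a]) auto
  ultimately show thesis using that by blast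
qed

text \<open>Every point of an interval lies on a geodesic, and every geodesic lies in the interval
  of its ends, so the slim-triangle constant carries over unchanged.\<close>

lemma ex_slim: "\<exists>\<delta>. slim \<delta>"
proof -
  obtain \<delta> where \<delta>: "\<delta> \<ge> 0"
    "\<And>x y z \<alpha> \<beta> \<gamma> p. \<lbrakk>x \<in> X; y \<in> X; z \<in> X; geodesic X d \<alpha> x y; geodesic X d \<beta> y z; geodesic X d \<gamma> x z;
      p \<in> \<alpha> ` {0..d x y}\<rbrakk> \<Longrightarrow> \<exists>q \<in> \<beta> ` {0..d y z} \<union> \<gamma> ` {0..d x z}. d p q \<le> \<delta>"
    using slim_triangles by metis
  have "\<exists>q\<in>metric_interval y z \<union> metric_interval x z. d p q \<le> \<delta>"
    if xyz: "x \<in> X" "y \<in> X" "z \<in> X" and p: "p \<in> metric_interval x y" for x y z p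
  proof -
    obtain \<alpha> \<beta> \<gamma> where g: "geodesic X d \<alpha> x y" "p \<in> \<alpha> ` {0..d x y}"
        "geodesic X d \<beta> y z" "geodesic X d \<gamma> x z"
      using geodesic_through[OF xyz(1,2) p] geodesic_exists xyz by metis
    then obtain q where "q \<in> \<beta> ` {0..d y z} \<union> \<gamma> ` {0..d x z}" "d p q \<le> \<delta>"
      using \<delta>(2)[OF xyz g(1,3,4,2)] by blast
    then show ?thesis
      using geodesic_image_subset[OF g(3)] geodesic_image_subset[OF g(4)] by blast
  qed
  then show ?thesis using \<delta>(1) unfolding slim_def by blast
qed

end

section \<open>Quasi-geodesics\<close>

text \<open>This caps the exponent \<open>k\<close> in the Morse lemma, where a power of two is
  compared with a linear function of \<open>k\<close>.\<close>

lemma ex_linear_less_power_two: "\<exists>k0. \<forall>k\<ge>k0. A * real k + B < 2 ^ k" if "A > 0"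
proof -
  have "eventually (\<lambda>k. A * real k + B < 2 ^ k) at_top"
    using that by real_asymp
  then show ?thesis by (simp add: eventually_sequentially)
qed

text \<open>A discrete quasi-geodesic. The bound on the steps gives
  \<open>d (a i) (a j) \<le> l * (j - i)\<close> for \<open>i \<le> j\<close>; the last clause is
  the converse estimate, solved for the index difference.\<close>

definition (in Metric_space) quasigeodesic_chain ::
  "real \<Rightarrow> real \<Rightarrow> real \<Rightarrow> nat \<Rightarrow> (nat \<Rightarrow> 'a) \<Rightarrow> bool" where
  "quasigeodesic_chain l K C N a \<longleftrightarrow>
     (\<forall>i\<le>N. a i \<in> M) \<and> (\<forall>i<N. d (a i) (a (Suc i)) \<le> l) \<and>
     (\<forall>i j. i \<le> j \<and> j \<le> N \<longrightarrow> real (j - i) \<le> K * d (a i) (a j) + C)"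

section \<open>Stability of quasi-geodesics\<close>

context hyperbolic_space
begin

text \<open>The estimate behind the Morse lemma: the point \<open>p\<close> is almost as far from the chain as any
  point of the interval. Walk from \<open>p\<close> a distance \<open>2 m\<close> towards both ends, jump to the
  chain and follow it; this detour has length linear in \<open>m\<close>, but stays away from \<open>p\<close>.\<close>

lemma quasigeodesic_detour:
  assumes sl: "slim \<delta>" and K: "K \<ge> 0" and l: "l \<ge> 0"
    and qg: "quasigeodesic_chain l K C N a"
    and cover: "\<And>u. u \<in> metric_interval (a 0) (a N) \<Longrightarrow> \<exists>i\<le>N. d u (a i) \<le> m"
    and p: "p \<in> metric_interval (a 0) (a N)"
    and far: "\<And>i. i \<le> N \<Longrightarrow> d p (a i) > m - 1"
    and n: "6 * K * m + C + 2 \<le> 2 ^ k"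
  shows "m \<le> real k * \<delta> + l + 1"
proof -
  have \<delta>: "\<delta> \<ge> 0" by (rule slim_nonneg[OF sl])
  have aM: "a i \<in> X" if "i \<le> N" for i
    using qg that by (auto simp: quasigeodesic_chain_def)
  note P = metric_intervalD[OF p]
  have "m \<ge> 0"
    using cover[OF p] nonneg order_trans by blast
  \<comment> \<open>If the end \<open>a e\<close> is less than \<open>2 * m\<close> away from
    \<open>p\<close>, the walk stops there; it is already on the chain, so the jump has length
    zero.\<close>
  have ends: "\<exists>y i. y \<in> metric_interval p (a e) \<and> i \<le> N \<and> d y (a i) \<le> m \<and> d p y \<le> 2 * m \<and>
      (d p y = 2 * m \<or> y = a i)" if e: "e = 0 \<or> e = N" for e
  proof (cases "2 * m \<le> d p (a e)")
    case True
    have eM: "a e \<in> X" using e aM by auto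
    obtain y where y: "y \<in> metric_interval p (a e)" "d p y = 2 * m"
      using point_at_distance[OF P(1) eM, of "2 * m"] True \<open>m \<ge> 0\<close> by auto
    have "y \<in> metric_interval (a 0) (a N)"
      using e
    proof
      assume "e = N"
      then show ?thesis
        using metric_interval_trans(1)[OF _ _ p] y aM by auto
    next
      assume "e = 0"
      then have "y \<in> metric_interval (a N) (a 0)"
        using metric_interval_trans(1)[of "a N" "a 0" p y] y p aM
        by (auto simp: metric_interval_commute)
      then show ?thesis by (simp add: metric_interval_commute)
    qed
    then show ?thesis using cover y by fastforce
  next
    case False
    then show ?thesis
      using e aM P \<open>m \<ge> 0\<close> by (intro exI[of _ "a e"] exI[of _ e]) (auto simp: metric_interval_ends)
  qed
  obtain y i where y: "y \<in> metric_interval p (a 0)" "i \<le> N" "d y (a i) \<le> m" "d p y \<le> 2 * m"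
      "d p y = 2 * m \<or> y = a i"
    using ends[of 0] by auto
  obtain z j where z: "z \<in> metric_interval p (a N)" "j \<le> N" "d z (a j) \<le> m" "d p z \<le> 2 * m"
      "d p z = 2 * m \<or> z = a j"
    using ends[of N] by auto
  note Y = metric_intervalD[OF y(1)] and Z = metric_intervalD[OF z(1)]
  \<comment> \<open>A jump has length at most \<open>m\<close> and starts at distance
    \<open>2 * m\<close> from \<open>p\<close>, so it stays at distance at least \<open>m\<close>
    from \<open>p\<close>. A degenerate jump is a point of the chain, where \<open>far\<close>
    applies.\<close>
  have near_end: "m \<le> real k * \<delta> + 1"
    if e: "e \<in> X" "e' \<le> N" "d e (a e') \<le> m" "d p e = 2 * m \<or> e = a e'"
      and u: "u \<in> metric_interval e (a e')" "d p u \<le> real k * \<delta>" for e e' u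
    using e(4)
  proof
    note U = metric_intervalD[OF u(1)]
    assume "d p e = 2 * m"
    moreover have "d p e \<le> d p u + d u e" using triangle P U e by blast
    moreover have "d u e \<le> m" using U e(3) nonneg[of u "a e'"] commute[of u e] by linarith
    ultimately show ?thesis using u(2) by linarith
  next
    assume "e = a e'"
    then have "u = e" using metric_interval_same u(1) e(1) by auto
    then show ?thesis using far[OF e(2)] u(2) \<open>e = a e'\<close> by simp
  qed
  have pyz: "p \<in> metric_interval y z"
  proof -
    have "p \<in> metric_interval (a 0) z"
      using metric_interval_trans(2)[OF _ _ p z(1)] aM by auto
    then have "p \<in> metric_interval z (a 0)" by (simp add: metric_interval_commute)
    from metric_interval_trans(2)[OF Z(1) _ this y(1)] show ?thesis
      using aM by (simp add: metric_interval_commute)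
  qed
  \<comment> \<open>\<open>r\<close> counts the chain steps between \<open>a i\<close> and
    \<open>a j\<close>, and \<open>b\<close> runs through the indices from \<open>i\<close> to
    \<open>j\<close> in whichever direction is required. The detour \<open>c\<close> is
    \<open>y\<close>, then \<open>a i\<close> to \<open>a j\<close>, then \<open>z\<close>: in all
    \<open>r + 2\<close> steps.\<close>
  define r where "r = (if i \<le> j then j - i else i - j)"
  define b where "b t = (if i \<le> j then i + t else i - t)" for t
  define c where "c t = (if t = 0 then y else if t = r + 2 then z else a (b (t - 1)))" for t
  have b: "b 0 = i" "b r = j" "b t \<le> N" if "t \<le> r" for t
    using y z that by (auto simp: b_def r_def)
  have bstep: "d (a (b t)) (a (b (Suc t))) \<le> l" if "t < r" for t
  proof (cases "i \<le> j")
    case True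
    then show ?thesis using qg that z by (auto simp: quasigeodesic_chain_def b_def r_def)
  next
    case False
    then have "b t = Suc (b (Suc t))" "b (Suc t) < N"
      using that y by (auto simp: b_def r_def)
    then show ?thesis using qg commute by (auto simp: quasigeodesic_chain_def)
  qed
  \<comment> \<open>Two jumps of length at most \<open>m\<close> and two walks of length at most
    \<open>2 * m\<close>.\<close>
  have "d (a i) (a j) \<le> 6 * m"
  proof -
    have "d (a i) (a j) \<le> d (a i) y + d y (a j)" "d y (a j) \<le> d y p + d p (a j)"
      "d p (a j) \<le> d p z + d z (a j)"
      using triangle aM Y Z P y z by auto
    then show ?thesis
      using y z commute[of "a i" y] commute[of y p] by linarith
  qed
  moreover have "real r \<le> K * d (a i) (a j) + C"
  proof (cases "i \<le> j")
    case True
    then show ?thesis using qg z by (auto simp: quasigeodesic_chain_def r_def)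
  next
    case False
    then have "real r \<le> K * d (a j) (a i) + C"
      using qg y by (auto simp: quasigeodesic_chain_def r_def)
    then show ?thesis by (simp add: commute)
  qed
  ultimately have "real r \<le> K * (6 * m) + C"
    using mult_left_mono[of _ _ K] K by fastforce
  with n have "real (r + 2) \<le> real (2 ^ k)" by (simp add: algebra_simps)
  then have "r + 2 \<le> 2 ^ k" by linarith
  moreover have "c t \<in> X" if "t \<le> r + 2" for t
    using that Y Z b(3)[of "t - 1"] aM by (auto simp: c_def)
  moreover have "p \<in> metric_interval (c 0) (c (r + 2))"
    using pyz by (simp add: c_def)
  ultimately obtain t u where t: "t < r + 2" and u: "u \<in> metric_interval (c t) (c (Suc t))"
      "d p u \<le> real k * \<delta>"
    using slim_chain[OF sl, of "r + 2" k c p] by auto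
  \<comment> \<open>The point \<open>u\<close> of the detour close to \<open>p\<close> lies on one
    of the two jumps or on a chain step. In the last case it is within \<open>l\<close> of a chain
    point.\<close>
  consider "t = 0" | "t = r + 1" | "0 < t" "t \<le> r"
    using t by linarith
  then show ?thesis
  proof cases
    case 1
    then have "u \<in> metric_interval y (a i)" using u b by (auto simp: c_def)
    from near_end[OF Y(1) y(2,3,5) this u(2)] l show ?thesis by simp
  next
    case 2
    then have "u \<in> metric_interval z (a j)"
      using u b by (auto simp: c_def metric_interval_commute)
    from near_end[OF Z(1) z(2,3,5) this u(2)] l show ?thesis by simp
  next
    case 3
    define s where "s = t - 1"
    have s: "s < r" "t = Suc s" using 3 by (auto simp: s_def)
    then have "u \<in> metric_interval (a (b s)) (a (b (Suc s)))"
      using u by (auto simp: c_def)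
    note U = metric_intervalD[OF this]
    have bs: "b s \<le> N" using b(3)[of s] s by simp
    have "d p (a (b s)) \<le> d p u + d u (a (b s))"
      using triangle P U aM[OF bs] by blast
    moreover have "d (a (b s)) u \<le> l"
      using U bstep[OF s(1)] nonneg[of u "a (b (Suc s))"] by linarith
    ultimately show ?thesis
      using far[OF bs] u(2) commute[of u "a (b s)"] by linarith
  qed
qed

text \<open>Take the least natural number \<open>m\<close> for which the interval lies in the
  \<open>m\<close>-neighbourhood of the chain. By minimality some point of the interval is more than
  \<open>m - 1\<close> away from the chain, and its detour bounds \<open>m\<close> linearly in
  \<open>k\<close> as soon as \<open>2 ^ k\<close> exceeds a linear function of \<open>m\<close>.
  The least such \<open>k\<close> is therefore bounded independently of the chain, and so is
  \<open>m\<close>.\<close>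

lemma Morse_lemma:
  assumes K: "K > 0" and l: "l \<ge> 0" and C: "C \<ge> 0"
  shows "\<exists>Q. \<forall>N a p. quasigeodesic_chain l K C N a \<and> p \<in> metric_interval (a 0) (a N)
    \<longrightarrow> (\<exists>i\<le>N. d p (a i) \<le> Q)"
proof -
  obtain \<delta> where sl: "slim \<delta>" using ex_slim by blast
  have \<delta>: "\<delta> \<ge> 0" by (rule slim_nonneg[OF sl])
  \<comment> \<open>With \<open>S = 6 * K * m + C + 2\<close> and
    \<open>m \<le> (k' + 1) * \<delta> + l + 1\<close> one gets
    \<open>2 * S \<le> A * k' + B\<close>. The summand 1 keeps \<open>A\<close> positive when
    \<open>\<delta>\<close> is zero.\<close>
  define A where "A = 12 * K * \<delta> + 1"
  define B where "B = 12 * K * (\<delta> + l + 1) + 2 * (C + 2)"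
  have "A > 0" using K \<delta> by (simp add: A_def add_nonneg_pos)
  then obtain k0 where k0: "\<And>k. k \<ge> k0 \<Longrightarrow> A * real k + B < 2 ^ k"
    using ex_linear_less_power_two by blast
  define Q where "Q = real (Suc k0) * \<delta> + l + 1"
  have "\<exists>i\<le>N. d p (a i) \<le> Q"
    if qg: "quasigeodesic_chain l K C N a" and p: "p \<in> metric_interval (a 0) (a N)" for N a p
  proof -
    have aM: "a i \<in> X" if "i \<le> N" for i
      using qg that by (auto simp: quasigeodesic_chain_def)
    define P where "P m \<longleftrightarrow> (\<forall>u\<in>metric_interval (a 0) (a N). \<exists>i\<le>N. d u (a i) \<le> real m)" for m
    \<comment> \<open>The chain point \<open>a 0\<close> alone gives a finite bound, so a least one
      exists.\<close>
    have "P (nat \<lceil>d (a 0) (a N)\<rceil>)"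
    proof -
      have "d u (a 0) \<le> d (a 0) (a N)" if "u \<in> metric_interval (a 0) (a N)" for u
        using metric_intervalD(2)[OF that] nonneg[of u "a N"] commute[of u "a 0"] by linarith
      then show ?thesis unfolding P_def
        using order_trans real_nat_ceiling_ge by blast
    qed
    then have Pm: "P (LEAST m. P m)" by (rule LeastI)
    define m where "m = (LEAST m. P m)"
    have "real m \<le> Q"
    proof (cases "m = 0")
      case True
      then show ?thesis using \<delta> l by (simp add: Q_def)
    next
      case False
      then have "\<not> P (m - 1)" unfolding m_def by (intro not_less_Least) simp
      then obtain v where v: "v \<in> metric_interval (a 0) (a N)" "\<And>i. i \<le> N \<Longrightarrow> d v (a i) > real m - 1"
        using False unfolding P_def by (fastforce simp: not_le)
      define S where "S = 6 * K * real m + C + 2"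
      have "\<exists>k. S \<le> 2 ^ k"
        using real_arch_pow[of 2 S] less_imp_le by auto
      then have Sk: "S \<le> 2 ^ (LEAST k. S \<le> 2 ^ k)" by (rule LeastI_ex)
      define k where "k = (LEAST k. S \<le> 2 ^ k)"
      have mk: "real m \<le> real k * \<delta> + l + 1"
        by (rule quasigeodesic_detour[OF sl _ l qg _ v])
          (use K Pm Sk in \<open>auto simp: P_def m_def S_def k_def\<close>)
      \<comment> \<open>Otherwise the predecessor \<open>k'\<close> of \<open>k\<close> satisfies
        \<open>2 ^ k' < S\<close> by minimality, and \<open>2 * S < 2 ^ k'\<close> by the choice of
        \<open>k0\<close>.\<close>
      have "k \<le> Suc k0"
      proof (rule ccontr)
        assume "\<not> k \<le> Suc k0"
        define k' where "k' = k - 1"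
        have k': "k = Suc k'" "k' \<ge> k0" using \<open>\<not> k \<le> Suc k0\<close> by (auto simp: k'_def)
        have "\<not> S \<le> 2 ^ k'"
          using not_less_Least[of k' "\<lambda>k. S \<le> 2 ^ k"] k' by (simp add: k_def)
        moreover have "2 * S \<le> A * real k' + B"
        proof -
          have "K * real m \<le> K * (real k * \<delta> + l + 1)"
            using K mk by (intro mult_left_mono) auto
          then have "2 * S \<le> 12 * (K * (real k * \<delta> + l + 1)) + 2 * (C + 2)"
            by (simp add: S_def)
          also have "\<dots> = 12 * K * \<delta> * real k' + B"
            by (simp add: B_def k' algebra_simps)
          also have "\<dots> \<le> A * real k' + B"
            by (simp add: A_def algebra_simps)
          finally show ?thesis .
        qed
        moreover have "0 \<le> S" using K C by (simp add: S_def)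
        ultimately show False using k0[OF k'(2)] by linarith
      qed
      then have "real k * \<delta> \<le> real (Suc k0) * \<delta>"
        using \<delta> by (intro mult_right_mono) auto
      then show ?thesis using mk by (simp add: Q_def)
    qed
    moreover obtain i where "i \<le> N" "d p (a i) \<le> real m"
      using Pm p unfolding P_def m_def by blast
    ultimately show ?thesis by (meson order_trans)
  qed
  then show ?thesis by blast
qed

end

section \<open>Words\<close>

context group
begin

lemma foldr_mult_closed: "set ws \<subseteq> carrier G \<Longrightarrow> foldr (\<otimes>) ws \<one> \<in> carrier G"
  by (induction ws) auto

lemma foldr_mult_append:
  "\<lbrakk>set us \<subseteq> carrier G; set vs \<subseteq> carrier G\<rbrakk>
    \<Longrightarrow> foldr (\<otimes>) (us @ vs) \<one> = foldr (\<otimes>) us \<one> \<otimes> foldr (\<otimes>) vs \<one>"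
  by (induction us) (auto simp: foldr_mult_closed m_assoc)

lemma generate_word:
  assumes "S \<subseteq> carrier G" "g \<in> generate G S"
  shows "\<exists>ws. set ws \<subseteq> S \<union> m_inv G ` S \<and> foldr (\<otimes>) ws \<one> = g"
  using assms(2)
proof (induction rule: generate.induct)
  case one
  show ?case by (intro exI[of _ "[]"]) auto
next
  case (incl h)
  then show ?case using assms(1) by (intro exI[of _ "[h]"]) auto
next
  case (inv h)
  then show ?case using assms(1) by (intro exI[of _ "[inv h]"]) auto
next
  case (eng g h)
  then obtain us vs where "set us \<subseteq> S \<union> m_inv G ` S" "foldr (\<otimes>) us \<one> = g"
      "set vs \<subseteq> S \<union> m_inv G ` S" "foldr (\<otimes>) vs \<one> = h"
    by blast
  moreover from this assms(1) have "set us \<subseteq> carrier G" "set vs \<subseteq> carrier G"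
    by auto
  ultimately show ?case
    using foldr_mult_append[of us vs] by (intro exI[of _ "us @ vs"]) (simp del: foldr_append)
qed

lemma word_length_le:
  "set ws \<subseteq> S \<union> m_inv G ` S \<Longrightarrow> word_length G S (foldr (\<otimes>) ws \<one>) \<le> length ws"
  unfolding word_length_def by (rule Least_le) blast

lemma word_length_word:
  assumes "S \<subseteq> carrier G" "g \<in> generate G S"
  obtains ws where "set ws \<subseteq> S \<union> m_inv G ` S" "length ws = word_length G S g"
    "foldr (\<otimes>) ws \<one> = g"
proof -
  have "\<exists>n ws. set ws \<subseteq> S \<union> m_inv G ` S \<and> length ws = n \<and> foldr (\<otimes>) ws \<one> = g"
    using generate_word[OF assms] by blast
  from LeastI_ex[OF this] show thesis
    using that unfolding word_length_def by blast
qed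

text \<open>Every element of the ball is the value of a word of length at most \<open>r\<close> over
  a finite alphabet.\<close>

lemma finite_word_ball:
  assumes "S \<subseteq> carrier G" "finite S"
  shows "finite {g \<in> generate G S. word_length G S g \<le> r}"
proof (rule finite_subset)
  show "{g \<in> generate G S. word_length G S g \<le> r} \<subseteq>
      (\<lambda>ws. foldr (\<otimes>) ws \<one>) ` {ws. set ws \<subseteq> S \<union> m_inv G ` S \<and> length ws \<le> r}"
  proof
    fix g assume g: "g \<in> {g \<in> generate G S. word_length G S g \<le> r}"
    then obtain ws where "set ws \<subseteq> S \<union> m_inv G ` S" "length ws = word_length G S g"
        "foldr (\<otimes>) ws \<one> = g"
      using word_length_word[OF assms(1)] by blast
    with g show "g \<in> (\<lambda>ws. foldr (\<otimes>) ws \<one>) ` {ws. set ws \<subseteq> S \<union> m_inv G ` S \<and> length ws \<le> r}"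
      by auto
  qed
  show "finite ((\<lambda>ws. foldr (\<otimes>) ws \<one>) ` {ws. set ws \<subseteq> S \<union> m_inv G ` S \<and> length ws \<le> r})"
    using assms(2) by (intro finite_imageI finite_lists_length_le) auto
qed

text \<open>The \<open>v i\<close> are the prefixes of a shortest word for \<open>g\<close>. A piece
  of a shortest word is itself shortest, which gives the lower bound between any two
  prefixes.\<close>

lemma geodesic_word:
  assumes S: "S \<subseteq> carrier G" and g: "g \<in> generate G S"
  obtains N v where "v 0 = \<one>" "v N = g" "\<And>i. v i \<in> generate G S"
    "\<And>i. i < N \<Longrightarrow> word_length G S (inv (v i) \<otimes> v (Suc i)) \<le> 1"
    "\<And>i j. \<lbrakk>i \<le> j; j \<le> N\<rbrakk> \<Longrightarrow> j - i \<le> word_length G S (inv (v i) \<otimes> v j)"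
proof -
  define T where "T = S \<union> m_inv G ` S"
  have T: "T \<subseteq> carrier G" using S by (auto simp: T_def)
  obtain ws where ws: "set ws \<subseteq> T" "length ws = word_length G S g" "foldr (\<otimes>) ws \<one> = g"
    using word_length_word[OF S g] unfolding T_def .
  interpret gen: subgroup "generate G S" G by (rule generate_is_subgroup[OF S])
  have TS: "T \<subseteq> generate G S" unfolding T_def by (auto intro: generate.intros)
  \<comment> \<open>Past the end of the word \<open>v i\<close> stays equal to \<open>g\<close>, so
    membership in the generated subgroup holds for every \<open>i\<close>.\<close>
  define v where "v i = foldr (\<otimes>) (take i ws) \<one>" for i
  have prod_gen: "foldr (\<otimes>) us \<one> \<in> generate G S" if "set us \<subseteq> T" for us
    using that
  proof (induction us)
    case (Cons a us)
    then have "a \<in> generate G S" using TS by auto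
    with Cons show ?case by simp
  qed simp
  have sub: "set (take i ws) \<subseteq> T" "set (drop i ws) \<subseteq> T" for i
    using ws(1) set_take_subset set_drop_subset by fast+
  have subG: "set (take i ws) \<subseteq> carrier G" "set (drop i ws) \<subseteq> carrier G" for i
    using sub T by blast+
  have vS: "v i \<in> generate G S" for i
    unfolding v_def by (rule prod_gen[OF sub(1)])
  have vG: "v i \<in> carrier G" for i using vS gen.subset by blast
  have step: "word_length G S (inv (v i) \<otimes> v (Suc i)) \<le> 1" if "i < length ws" for i
  proof -
    have w: "ws ! i \<in> T" using that ws(1) by auto
    then have wG: "ws ! i \<in> carrier G" using T by blast
    have "v (Suc i) = v i \<otimes> foldr (\<otimes>) [ws ! i] \<one>"
      unfolding v_def take_Suc_conv_app_nth[OF that]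
      by (rule foldr_mult_append) (use subG wG in auto)
    then have "inv (v i) \<otimes> v (Suc i) = foldr (\<otimes>) [ws ! i] \<one>"
      using vG[of i] wG by (simp add: m_assoc[symmetric])
    then show ?thesis
      using word_length_le[of "[ws ! i]" S] w by (simp add: T_def)
  qed
  have far: "j - i \<le> word_length G S (inv (v i) \<otimes> v j)" if "i \<le> j" "j \<le> length ws" for i j
  proof -
    have "inv (v i) \<otimes> v j \<in> generate G S" using vS by auto
    then obtain us where us: "set us \<subseteq> T" "length us = word_length G S (inv (v i) \<otimes> v j)"
        "foldr (\<otimes>) us \<one> = inv (v i) \<otimes> v j"
      using word_length_word[OF S] unfolding T_def by blast
    have usG: "set us \<subseteq> carrier G" using us(1) T by blast
    \<comment> \<open>Replacing the piece between positions \<open>i\<close> and \<open>j\<close> by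
      a shortest word \<open>us\<close> gives another word for \<open>g\<close>, which cannot be
      shorter than \<open>ws\<close>.\<close>
    have "foldr (\<otimes>) (take i ws @ us @ drop j ws) \<one> =
        v i \<otimes> ((inv (v i) \<otimes> v j) \<otimes> foldr (\<otimes>) (drop j ws) \<one>)"
      using usG subG us(3) by (simp add: foldr_mult_append v_def del: foldr_append)
    also have "\<dots> = v j \<otimes> foldr (\<otimes>) (drop j ws) \<one>"
    proof -
      have "v i \<otimes> (inv (v i) \<otimes> v j) = v j"
        using vG by (simp add: m_assoc[symmetric])
      then show ?thesis
        using vG foldr_mult_closed[OF subG(2)] by (simp add: m_assoc[symmetric])
    qed
    also have "\<dots> = foldr (\<otimes>) (take j ws @ drop j ws) \<one>"
      unfolding v_def by (rule foldr_mult_append[symmetric]) (use subG in auto)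
    finally have "foldr (\<otimes>) (take i ws @ us @ drop j ws) \<one> = g" using ws by simp
    moreover have "set (take i ws @ us @ drop j ws) \<subseteq> T"
      using sub us(1) by auto
    ultimately have "word_length G S g \<le> length (take i ws @ us @ drop j ws)"
      using word_length_le[of "take i ws @ us @ drop j ws" S] by (simp add: T_def)
    then show ?thesis using that us(2) ws(2) by simp
  qed
  show thesis
  proof (rule that[of v "length ws"])
    show "v 0 = \<one>" "v (length ws) = g"
      using ws(3) by (simp_all add: v_def)
  qed (use vS in blast, use step in blast, use far in blast)
qed

end

section \<open>Orbits of isometric actions\<close>

sublocale isometric_action \<subseteq> group G
  using group_hom group_hom.axioms(1) by blast

lemma acylindrical_alongE:
  assumes "acylindrical_along G d \<phi> Y" "\<epsilon> \<ge> 0"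
  obtains R and M :: nat where "R > 0" "M > 0"
    "\<And>x y. \<lbrakk>x \<in> Y; y \<in> Y; d x y \<ge> R\<rbrakk> \<Longrightarrow>
      finite {g \<in> carrier G. d (\<phi> g x) x \<le> \<epsilon> \<and> d (\<phi> g y) y \<le> \<epsilon>} \<and>
      card {g \<in> carrier G. d (\<phi> g x) x \<le> \<epsilon> \<and> d (\<phi> g y) y \<le> \<epsilon>} \<le> M"
proof -
  from assms(1)[unfolded acylindrical_along_def, rule_format, OF assms(2)]
  show thesis by (elim exE conjE) (rule that, assumption+, blast)
qed

context isometric_action
begin

lemma act_closed: "\<lbrakk>g \<in> carrier G; x \<in> X\<rbrakk> \<Longrightarrow> \<phi> g x \<in> X"
  using element_image by blast

lemma act_one: "x \<in> X \<Longrightarrow> \<phi> \<one> x = x"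
  by (metis id_eq_one restrict_apply')

lemma dist_act_act:
  assumes "g \<in> carrier G" "h \<in> carrier G" "x \<in> X"
  shows "d (\<phi> g x) (\<phi> h x) = d x (\<phi> (inv g \<otimes> h) x)"
proof -
  have "d (\<phi> g x) (\<phi> h x) = d (\<phi> (inv g) (\<phi> g x)) (\<phi> (inv g) (\<phi> h x))"
    using assms by (simp add: isometry act_closed)
  also have "\<dots> = d x (\<phi> (inv g \<otimes> h) x)"
    using assms by (simp add: composition_rule orbit_sym_aux)
  finally show ?thesis .
qed

lemma dist_act_mult:
  assumes "f \<in> carrier G" "g \<in> carrier G" "h \<in> carrier G" "x \<in> X"
  shows "d (\<phi> (f \<otimes> g) x) (\<phi> (f \<otimes> h) x) = d (\<phi> g x) (\<phi> h x)"
  using assms by (simp add: composition_rule isometry act_closed)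

text \<open>Acylindricity and the quasi-isometric embedding may be given with different base points;
  this brings them to the same one. Corresponding orbit points are at distance
  \<open>c = d x x'\<close>, so displacements and distances change by at most \<open>2 * c\<close>:
  the constants for \<epsilon> at \<open>x\<close> come from those for
  \<open>\<epsilon> + 2 * c\<close> at \<open>x'\<close>.\<close>

lemma acylindrical_along_orbit:
  assumes H: "H \<subseteq> carrier G" and x: "x \<in> X" "x' \<in> X"
    and acyl: "acylindrical_along G d \<phi> ((\<lambda>h. \<phi> h x') ` H)"
  shows "acylindrical_along G d \<phi> ((\<lambda>h. \<phi> h x) ` H)"
  unfolding acylindrical_along_def
proof (intro allI impI)
  fix \<epsilon> :: real assume "\<epsilon> \<ge> 0"
  define c where "c = d x x'"
  define A where "A e u v = {g \<in> carrier G. d (\<phi> g u) u \<le> e \<and> d (\<phi> g v) v \<le> e}" for e u v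
  have "\<epsilon> + 2 * c \<ge> 0" using \<open>\<epsilon> \<ge> 0\<close> by (simp add: c_def)
  then obtain R M where R: "R > 0" "M > 0"
    and RM: "\<And>u v. \<lbrakk>u \<in> (\<lambda>h. \<phi> h x') ` H; v \<in> (\<lambda>h. \<phi> h x') ` H; d u v \<ge> R\<rbrakk>
      \<Longrightarrow> finite (A (\<epsilon> + 2 * c) u v) \<and> card (A (\<epsilon> + 2 * c) u v) \<le> (M::nat)"
    unfolding A_def by (rule acylindrical_alongE[OF acyl]) blast
  have move: "d (\<phi> g (\<phi> h x')) (\<phi> h x') \<le> \<epsilon> + 2 * c"
    if "g \<in> carrier G" "h \<in> H" "d (\<phi> g (\<phi> h x)) (\<phi> h x) \<le> \<epsilon>" for g h
  proof -
    have hG: "h \<in> carrier G" using that H by blast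
    have X: "\<phi> h x \<in> X" "\<phi> h x' \<in> X" using hG x act_closed by auto
    then have X': "\<phi> g (\<phi> h x) \<in> X" "\<phi> g (\<phi> h x') \<in> X" using that act_closed by auto
    have "d (\<phi> h x) (\<phi> h x') = c" using hG x by (simp add: isometry c_def)
    moreover have "d (\<phi> g (\<phi> h x')) (\<phi> g (\<phi> h x)) = c"
      using calculation that X by (simp add: isometry commute)
    moreover have "d (\<phi> g (\<phi> h x')) (\<phi> h x') \<le>
        d (\<phi> g (\<phi> h x')) (\<phi> g (\<phi> h x)) + d (\<phi> g (\<phi> h x)) (\<phi> h x')"
      "d (\<phi> g (\<phi> h x)) (\<phi> h x') \<le> d (\<phi> g (\<phi> h x)) (\<phi> h x) + d (\<phi> h x) (\<phi> h x')"
      using triangle X X' by auto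
    ultimately show ?thesis using that by linarith
  qed
  have "finite (A \<epsilon> u v) \<and> card (A \<epsilon> u v) \<le> M"
    if uv: "u \<in> (\<lambda>h. \<phi> h x) ` H" "v \<in> (\<lambda>h. \<phi> h x) ` H" "d u v \<ge> R + 2 * c" for u v
  proof -
    obtain h k where hk: "h \<in> H" "k \<in> H" "u = \<phi> h x" "v = \<phi> k x" using uv by blast
    have G: "h \<in> carrier G" "k \<in> carrier G" using hk H by auto
    have X: "\<phi> h x \<in> X" "\<phi> h x' \<in> X" "\<phi> k x \<in> X" "\<phi> k x' \<in> X"
      using G x act_closed by auto
    have "d (\<phi> h x) (\<phi> h x') = c" "d (\<phi> k x') (\<phi> k x) = c"
      using G x by (simp_all add: isometry c_def commute)
    moreover have "d (\<phi> h x) (\<phi> k x) \<le> d (\<phi> h x) (\<phi> h x') + d (\<phi> h x') (\<phi> k x)"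
      "d (\<phi> h x') (\<phi> k x) \<le> d (\<phi> h x') (\<phi> k x') + d (\<phi> k x') (\<phi> k x)"
      using triangle X by auto
    ultimately have "d (\<phi> h x') (\<phi> k x') \<ge> R" using uv(3)[unfolded hk(3,4)] by linarith
    then have "finite (A (\<epsilon> + 2 * c) (\<phi> h x') (\<phi> k x')) \<and>
        card (A (\<epsilon> + 2 * c) (\<phi> h x') (\<phi> k x')) \<le> M"
      using RM hk by blast
    moreover have "A \<epsilon> u v \<subseteq> A (\<epsilon> + 2 * c) (\<phi> h x') (\<phi> k x')"
      using move hk by (auto simp: A_def)
    ultimately show ?thesis by (meson card_mono finite_subset order_trans)
  qed
  moreover have "R + 2 * c > 0" using R by (simp add: c_def add_pos_nonneg)
  ultimately show "\<exists>R>0. \<exists>M::nat. M > 0 \<and>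
     (\<forall>u\<in>(\<lambda>h. \<phi> h x) ` H. \<forall>v\<in>(\<lambda>h. \<phi> h x) ` H. d u v \<ge> R \<longrightarrow>
       finite {g \<in> carrier G. d (\<phi> g u) u \<le> \<epsilon> \<and> d (\<phi> g v) v \<le> \<epsilon>} \<and>
       card {g \<in> carrier G. d (\<phi> g u) u \<le> \<epsilon> \<and> d (\<phi> g v) v \<le> \<epsilon>} \<le> M)"
    using R(2) unfolding A_def by blast
qed

end

section \<open>Quasi-convex orbits and the bound on the height\<close>

context AQI_triple
begin

text \<open>The lower quasi-isometry inequality turns a bound on the displacement of
  \<open>x\<close> into a bound on word length.\<close>

lemma orbit_ball_finite:
  assumes S: "finite_generating_set G H S" and x: "x \<in> X"
    and qi: "quasi_isometric_embedding H (word_metric G S) X d (\<lambda>h. \<phi> h x)"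
  shows "finite {h \<in> H. d x (\<phi> h x) \<le> T}"
proof -
  obtain K C where K: "K \<ge> 1"
    and lower: "\<And>g h. \<lbrakk>g \<in> H; h \<in> H\<rbrakk> \<Longrightarrow> word_metric G S g h / K - C \<le> d (\<phi> g x) (\<phi> h x)"
    using qi unfolding quasi_isometric_embedding_def by blast
  have gen: "S \<subseteq> carrier G" "finite S" "generate G S = H"
    using S subset by (auto simp: finite_generating_set_def)
  have "word_length G S h \<le> nat \<lfloor>K * (T + C)\<rfloor>" if h: "h \<in> H" "d x (\<phi> h x) \<le> T" for h
  proof -
    have "word_metric G S \<one> h / K - C \<le> T"
      using lower[OF one_closed h(1)] h(2) x by (simp add: act_one)
    then have "word_length G S h / K \<le> T + C"
      using h(1) by (simp add: word_metric_def)
    then have "word_length G S h \<le> K * (T + C)"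
      using K by (simp add: field_simps)
    then show ?thesis by linarith
  qed
  then have "{h \<in> H. d x (\<phi> h x) \<le> T} \<subseteq> {h \<in> generate G S. word_length G S h \<le> nat \<lfloor>K * (T + C)\<rfloor>}"
    using gen by auto
  then show ?thesis
    using finite_word_ball[OF gen(1,2)] finite_subset by blast
qed

text \<open>The prefixes of a shortest word for \<open>h\<close> give a quasi-geodesic chain in the
  orbit, and the Morse lemma applies. Translation by \<open>f\<close> is an isometry, so
  \<open>Q\<close> is the same for all translates.\<close>

lemma orbit_quasiconvex:
  assumes S: "finite_generating_set G H S" and x: "x \<in> X"
    and qi: "quasi_isometric_embedding H (word_metric G S) X d (\<lambda>h. \<phi> h x)"
  shows "\<exists>Q. \<forall>f\<in>carrier G. \<forall>h\<in>H. \<forall>p\<in>metric_interval (\<phi> f x) (\<phi> (f \<otimes> h) x).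
    \<exists>h'\<in>H. d p (\<phi> (f \<otimes> h') x) \<le> Q"
proof -
  obtain K C where K: "K \<ge> 1" and C: "C \<ge> 0"
    and lower: "\<And>g h. \<lbrakk>g \<in> H; h \<in> H\<rbrakk> \<Longrightarrow> word_metric G S g h / K - C \<le> d (\<phi> g x) (\<phi> h x)"
    and upper: "\<And>g h. \<lbrakk>g \<in> H; h \<in> H\<rbrakk> \<Longrightarrow> d (\<phi> g x) (\<phi> h x) \<le> K * word_metric G S g h + C"
    using qi unfolding quasi_isometric_embedding_def by blast
  have gen: "S \<subseteq> carrier G" "generate G S = H"
    using S subset by (auto simp: finite_generating_set_def)
  have "K > 0" "K + C \<ge> 0" "K * C \<ge> 0" using K C by auto
  from Morse_lemma[OF this] obtain Q where Q: "\<And>N a p. \<lbrakk>quasigeodesic_chain (K + C) K (K * C) N a;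
      p \<in> metric_interval (a 0) (a N)\<rbrakk> \<Longrightarrow> \<exists>i\<le>N. d p (a i) \<le> Q"
    by blast
  have "\<exists>h'\<in>H. d p (\<phi> (f \<otimes> h') x) \<le> Q"
    if f: "f \<in> carrier G" and h: "h \<in> H" and p: "p \<in> metric_interval (\<phi> f x) (\<phi> (f \<otimes> h) x)" for f h p
  proof -
    obtain N v where v: "v 0 = \<one>" "v N = h" "\<And>i. v i \<in> H"
      and short: "\<And>i. i < N \<Longrightarrow> word_length G S (inv (v i) \<otimes> v (Suc i)) \<le> 1"
      and long: "\<And>i j. \<lbrakk>i \<le> j; j \<le> N\<rbrakk> \<Longrightarrow> j - i \<le> word_length G S (inv (v i) \<otimes> v j)"
      using geodesic_word[of S h] gen h by metis
    define a where "a i = \<phi> (f \<otimes> v i) x" for i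
    have da: "d (a i) (a j) = d (\<phi> (v i) x) (\<phi> (v j) x)" for i j
      unfolding a_def using dist_act_mult f v(3) x mem_carrier by blast
    have "d (a i) (a (Suc i)) \<le> K + C" if "i < N" for i
    proof -
      have "K * word_metric G S (v i) (v (Suc i)) \<le> K * 1"
        using short[OF that] K by (intro mult_left_mono) (auto simp: word_metric_def)
      then show ?thesis using upper[OF v(3) v(3), of i "Suc i"] by (simp add: da)
    qed
    moreover have "real (j - i) \<le> K * d (a i) (a j) + K * C" if "i \<le> j" "j \<le> N" for i j
    proof -
      have "real (j - i) \<le> word_metric G S (v i) (v j)"
        using long[OF that] by (simp add: word_metric_def)
      moreover have "word_metric G S (v i) (v j) / K \<le> d (a i) (a j) + C"
        using lower[OF v(3) v(3), of i j] by (simp add: da)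
      then have "word_metric G S (v i) (v j) \<le> K * d (a i) (a j) + K * C"
        using K by (simp add: field_simps)
      ultimately show ?thesis by linarith
    qed
    moreover have "a i \<in> X" for i
      unfolding a_def using act_closed f v(3) x mem_carrier by blast
    ultimately have "quasigeodesic_chain (K + C) K (K * C) N a"
      by (simp add: quasigeodesic_chain_def)
    moreover have "p \<in> metric_interval (a 0) (a N)"
      using p v f by (simp add: a_def)
    ultimately obtain i where "d p (a i) \<le> Q" using Q by blast
    then show ?thesis using v(3) unfolding a_def by blast
  qed
  then show ?thesis by blast
qed

text \<open>An element \<open>k\<close> of all the conjugates which moves a base point far moves all the points
  \<open>g i x\<close> far, along nearly the same interval. No element of infinite order is needed.\<close>

lemma conjugates_near_common_pair:
  assumes sl: "slim \<delta>" and x: "x \<in> X" and L: "L \<ge> 0"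
    and qc: "\<And>f h p. \<lbrakk>f \<in> carrier G; h \<in> H; p \<in> metric_interval (\<phi> f x) (\<phi> (f \<otimes> h) x)\<rbrakk>
      \<Longrightarrow> \<exists>h'\<in>H. d p (\<phi> (f \<otimes> h') x) \<le> Q"
    and fin: "\<And>T. finite {h \<in> H. d x (\<phi> h x) \<le> T}"
    and I: "finite I" "I \<noteq> {}" and g: "\<And>i. i \<in> I \<Longrightarrow> g i \<in> carrier G"
    and inf: "infinite (\<Inter>i\<in>I. g i <# H #> inv (g i))"
  shows "\<exists>p\<in>X. \<exists>q\<in>X. d p q = L \<and> (\<forall>i\<in>I. \<exists>a\<in>H. \<exists>b\<in>H.
    d p (\<phi> (g i \<otimes> a) x) \<le> 2 * \<delta> + Q \<and> d q (\<phi> (g i \<otimes> b) x) \<le> 2 * \<delta> + Q)"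
proof -
  have \<delta>: "\<delta> \<ge> 0" by (rule slim_nonneg[OF sl])
  obtain i0 where i0: "i0 \<in> I" using I by blast
  define y where "y i = \<phi> (g i) x" for i
  define A where "A = (\<Inter>i\<in>I. g i <# H #> inv (g i))"
  define C where "C = Max ((\<lambda>i. d (y i0) (y i)) ` I)"
  \<comment> \<open>Room for \<open>p\<close> at distance \<open>C + 2 * \<delta> + 1\<close> from
    one end, for \<open>q\<close> a further \<open>L\<close> along, and for the same margin at the
    other end.\<close>
  define T where "T = 2 * C + 4 * \<delta> + L + 2"
  have yX: "y i \<in> X" if "i \<in> I" for i
    using that g x act_closed by (simp add: y_def)
  have C: "d (y i0) (y i) \<le> C" if "i \<in> I" for i
    using I that by (auto simp: C_def)
  have "C \<ge> 0" using C[OF i0] nonneg order_trans by blast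
  \<comment> \<open>As \<open>k\<close> is the conjugate of \<open>h\<close> by \<open>g i\<close>,
    it sends the base point \<open>y i\<close> to another point of the same translate of the orbit
    of \<open>H\<close>.\<close>
  have conj: "\<exists>h\<in>H. k = g i \<otimes> h \<otimes> inv (g i) \<and> k \<in> carrier G \<and> \<phi> k (y i) = \<phi> (g i \<otimes> h) x"
    if k: "k \<in> A" and i: "i \<in> I" for k i
  proof -
    have "k \<in> g i <# H #> inv (g i)" using k i by (auto simp: A_def)
    then obtain h where h: "h \<in> H" "k = g i \<otimes> h \<otimes> inv (g i)"
      by (auto simp: l_coset_def r_coset_def)
    have G: "g i \<in> carrier G" "h \<in> carrier G" using g i h subset by auto
    then have kG: "k \<in> carrier G" by (simp add: h)
    have "\<phi> k (y i) = \<phi> (k \<otimes> g i) x"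
      using kG G x by (simp add: y_def composition_rule)
    also have "k \<otimes> g i = g i \<otimes> h" using G by (simp add: h m_assoc)
    finally show ?thesis using h kG by blast
  qed
  \<comment> \<open>Otherwise \<open>A\<close> would lie in a conjugate of a finite ball of
    \<open>H\<close>.\<close>
  have "\<exists>k\<in>A. d (y i0) (\<phi> k (y i0)) > T"
  proof (rule ccontr)
    assume "\<not> ?thesis"
    then have le: "d (y i0) (\<phi> k (y i0)) \<le> T" if "k \<in> A" for k
      using that by (meson not_le)
    have "A \<subseteq> (\<lambda>h. g i0 \<otimes> h \<otimes> inv (g i0)) ` {h \<in> H. d x (\<phi> h x) \<le> T}"
    proof
      fix k assume k: "k \<in> A"
      obtain h where h: "h \<in> H" "k = g i0 \<otimes> h \<otimes> inv (g i0)" "\<phi> k (y i0) = \<phi> (g i0 \<otimes> h) x"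
        using conj[OF k i0] by blast
      have G: "g i0 \<in> carrier G" "h \<in> carrier G" using g i0 h subset by auto
      have "d (y i0) (\<phi> k (y i0)) = d (\<phi> (g i0) x) (\<phi> (g i0 \<otimes> h) x)"
        unfolding h(3) by (simp add: y_def)
      also have "\<dots> = d x (\<phi> h x)"
        using G x by (simp add: composition_rule isometry act_closed)
      finally have "d (y i0) (\<phi> k (y i0)) = d x (\<phi> h x)" .
      then show "k \<in> (\<lambda>h. g i0 \<otimes> h \<otimes> inv (g i0)) ` {h \<in> H. d x (\<phi> h x) \<le> T}"
        using le[OF k] h by auto
    qed
    then have "finite A" using fin by (meson finite_imageI finite_subset)
    then show False using inf by (simp add: A_def)
  qed
  then obtain k where k: "k \<in> A" "d (y i0) (\<phi> k (y i0)) > T" by blast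
  define z where "z i = \<phi> k (y i)" for i
  have kG: "k \<in> carrier G" using conj[OF k(1) i0] by blast
  have zX: "z i \<in> X" if "i \<in> I" for i
    using yX[OF that] kG act_closed by (simp add: z_def)
  have long: "d (y i0) (z i0) > T" using k by (simp add: z_def)
  have Cz: "d (z i0) (z i) \<le> C" if "i \<in> I" for i
    using C[OF that] kG yX i0 that by (simp add: z_def isometry)
  \<comment> \<open>The quadrilateral moves \<open>r\<close> to the interval from \<open>y i\<close>
    to \<open>z i\<close>, and quasi-convexity moves it on to the translate by
    \<open>g i\<close>.\<close>
  have near: "\<exists>h\<in>H. d r (\<phi> (g i \<otimes> h) x) \<le> 2 * \<delta> + Q"
    if r: "r \<in> metric_interval (y i0) (z i0)" "d (y i0) r > C + 2 * \<delta>" "d r (z i0) > C + 2 * \<delta>"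
      and i: "i \<in> I" for r i
  proof -
    obtain r' where r': "r' \<in> metric_interval (y i) (z i)" "d r r' \<le> 2 * \<delta>"
      using slim_quadrilateral[OF sl yX[OF i0] zX[OF i0] yX[OF i] zX[OF i] C[OF i] Cz[OF i] r] by blast
    obtain h where h: "h \<in> H" "z i = \<phi> (g i \<otimes> h) x"
      using conj[OF k(1) i] by (auto simp: z_def)
    obtain h' where h': "h' \<in> H" "d r' (\<phi> (g i \<otimes> h') x) \<le> Q"
      using qc[OF g[OF i] h(1), of r'] r' h by (auto simp: y_def)
    have "\<phi> (g i \<otimes> h') x \<in> X"
      using act_closed g[OF i] h' x mem_carrier by blast
    then have "d r (\<phi> (g i \<otimes> h') x) \<le> d r r' + d r' (\<phi> (g i \<otimes> h') x)"
      using triangle r(1) r'(1) metric_intervalD(1) by blast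
    then show ?thesis using h' r' by force
  qed
  obtain p where p: "p \<in> metric_interval (y i0) (z i0)" "d (y i0) p = C + 2 * \<delta> + 1"
    using point_at_distance[OF yX[OF i0] zX[OF i0], of "C + 2 * \<delta> + 1"] long L \<delta> \<open>C \<ge> 0\<close>
    by (auto simp: T_def)
  note P = metric_intervalD[OF p(1)]
  obtain q where q: "q \<in> metric_interval p (z i0)" "d p q = L"
    using point_at_distance[OF P(1) zX[OF i0] L] P long p \<delta> \<open>C \<ge> 0\<close> by (auto simp: T_def)
  note Q = metric_intervalD[OF q(1)]
  have q': "q \<in> metric_interval (y i0) (z i0)" "p \<in> metric_interval (y i0) q"
    using metric_interval_trans[OF yX[OF i0] zX[OF i0] p(1) q(1)] by auto
  have "d p (z i0) > C + 2 * \<delta>" "d q (z i0) > C + 2 * \<delta>" "d (y i0) q > C + 2 * \<delta>"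
    using P Q metric_intervalD(2)[OF q'(2)] long p q L \<delta> \<open>C \<ge> 0\<close> by (auto simp: T_def)
  then have "\<forall>i\<in>I. \<exists>a\<in>H. \<exists>b\<in>H.
      d p (\<phi> (g i \<otimes> a) x) \<le> 2 * \<delta> + Q \<and> d q (\<phi> (g i \<otimes> b) x) \<le> 2 * \<delta> + Q"
    using near[OF p(1)] near[OF q'(1)] p(2) by simp
  then show ?thesis using P(1) Q(1) q(2) by blast
qed

text \<open>Sort the indices by the value of \<open>c i\<close>, the inverse of \<open>a i\<close>
  times \<open>b i\<close>. These values lie in a finite ball of \<open>H\<close>, and acylindricity
  at \<open>x\<close> and its image under the common value allows at most \<open>M\<close> indices
  for each of them.\<close>

lemma card_cosets_near_pair_le:
  assumes x: "x \<in> X" and D: "D \<ge> 0"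
    and fin: "finite {h \<in> H. d x (\<phi> h x) \<le> L + 2 * D}"
    and acyl: "\<And>c. \<lbrakk>c \<in> H; d x (\<phi> c x) \<ge> L - 2 * D\<rbrakk> \<Longrightarrow>
      finite {f \<in> carrier G. d (\<phi> f x) x \<le> 2 * D \<and> d (\<phi> f (\<phi> c x)) (\<phi> c x) \<le> 2 * D} \<and>
      card {f \<in> carrier G. d (\<phi> f x) x \<le> 2 * D \<and> d (\<phi> f (\<phi> c x)) (\<phi> c x) \<le> 2 * D} \<le> M"
    and pq: "p \<in> X" "q \<in> X" "d p q = L"
    and I: "finite I" and g: "\<And>i. i \<in> I \<Longrightarrow> g i \<in> carrier G" and inj: "inj_on (\<lambda>i. g i <# H) I"
    and near: "\<And>i. i \<in> I \<Longrightarrow> \<exists>a\<in>H. \<exists>b\<in>H. d p (\<phi> (g i \<otimes> a) x) \<le> D \<and> d q (\<phi> (g i \<otimes> b) x) \<le> D"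
  shows "card I \<le> card {h \<in> H. d x (\<phi> h x) \<le> L + 2 * D} * M"
proof -
  obtain a b where ab: "\<And>i. i \<in> I \<Longrightarrow> a i \<in> H \<and> b i \<in> H \<and>
      d p (\<phi> (g i \<otimes> a i) x) \<le> D \<and> d q (\<phi> (g i \<otimes> b i) x) \<le> D"
    using near by metis
  define f where "f i = g i \<otimes> a i" for i
  define c where "c i = inv (a i) \<otimes> b i" for i
  define B where "B = {h \<in> H. d x (\<phi> h x) \<le> L + 2 * D}"
  have G: "g i \<in> carrier G" "a i \<in> carrier G" "b i \<in> carrier G" "f i \<in> carrier G" "c i \<in> carrier G"
    if "i \<in> I" for i
    using that g ab mem_carrier by (auto simp: f_def c_def)
  have cH: "c i \<in> H" if "i \<in> I" for i
    using ab[OF that] by (simp add: c_def)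
  have fc: "f i \<otimes> c i = g i \<otimes> b i" if "i \<in> I" for i
  proof -
    have "a i \<otimes> (inv (a i) \<otimes> b i) = b i"
      using G[OF that] by (simp add: m_assoc[symmetric])
    then show ?thesis using G[OF that] by (simp add: f_def c_def m_assoc)
  qed
  have fp: "d p (\<phi> (f i) x) \<le> D" and fq: "d q (\<phi> (f i \<otimes> c i) x) \<le> D" if "i \<in> I" for i
    using ab[OF that] fc[OF that] by (auto simp: f_def)
  have fX: "\<phi> (f i) x \<in> X" "\<phi> (f i \<otimes> c i) x \<in> X" if "i \<in> I" for i
    using G[OF that] x act_closed by auto
  have c_bounds: "d x (\<phi> (c i) x) \<le> L + 2 * D" "d x (\<phi> (c i) x) \<ge> L - 2 * D" if i: "i \<in> I" for i
  proof -
    have "d x (\<phi> (c i) x) = d (\<phi> (f i) x) (\<phi> (f i \<otimes> c i) x)"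
      using G[OF i] x by (simp add: composition_rule isometry act_closed)
    moreover have "d (\<phi> (f i) x) (\<phi> (f i \<otimes> c i) x) \<le> d (\<phi> (f i) x) p + d p (\<phi> (f i \<otimes> c i) x)"
      "d p (\<phi> (f i \<otimes> c i) x) \<le> d p q + d q (\<phi> (f i \<otimes> c i) x)"
      "d p q \<le> d p (\<phi> (f i) x) + d (\<phi> (f i) x) q"
      "d (\<phi> (f i) x) q \<le> d (\<phi> (f i) x) (\<phi> (f i \<otimes> c i) x) + d (\<phi> (f i \<otimes> c i) x) q"
      using triangle pq fX[OF i] by auto
    ultimately show "d x (\<phi> (c i) x) \<le> L + 2 * D" "d x (\<phi> (c i) x) \<ge> L - 2 * D"
      using fp[OF i] fq[OF i] pq(3) commute[of p "\<phi> (f i) x"] commute[of q "\<phi> (f i \<otimes> c i) x"]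
      by linarith+
  qed
  have f_coset: "f i <# H = g i <# H" if i: "i \<in> I" for i
  proof -
    have "f i <# H = g i <# (a i <# H)"
      using G[OF i] subset by (simp add: f_def lcos_m_assoc)
    also have "a i <# H = H"
      using coset_join3[OF G(2)[OF i] is_subgroup] ab[OF i] by blast
    finally show ?thesis .
  qed
  \<comment> \<open>The \<open>f i\<close> are distinct because they represent the distinct cosets
    of the \<open>g i\<close>.\<close>
  have f_inj: "i = j" if "i \<in> I" "j \<in> I" "f i = f j" for i j
    using inj_onD[OF inj, of i j] f_coset that by metis
  have fibre: "card {i \<in> I. c i = e} \<le> M" for e
  proof (cases "{i \<in> I. c i = e} = {}")
    case True
    show ?thesis unfolding True by simp
  next
    case False
    then obtain j where j: "j \<in> I" "c j = e" by blast
    define A where "A = {h \<in> carrier G. d (\<phi> h x) x \<le> 2 * D \<and> d (\<phi> h (\<phi> e x)) (\<phi> e x) \<le> 2 * D}"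
    have A: "finite A" "card A \<le> M"
      using acyl[OF cH[OF j(1)] c_bounds(2)[OF j(1)]] j(2) by (auto simp: A_def)
    have "inj_on (\<lambda>i. inv (f j) \<otimes> f i) {i \<in> I. c i = e}"
    proof (rule inj_onI)
      fix i i' assume i: "i \<in> {i \<in> I. c i = e}" "i' \<in> {i \<in> I. c i = e}"
        and "inv (f j) \<otimes> f i = inv (f j) \<otimes> f i'"
      then have "f i = f i'" using G j by auto
      then show "i = i'" using f_inj i by blast
    qed
    \<comment> \<open>Both \<open>f i\<close> and \<open>f j\<close> send \<open>x\<close> to within
      \<open>D\<close> of \<open>p\<close>, and the image of \<open>x\<close> under \<open>e\<close>
      to within \<open>D\<close> of \<open>q\<close>.\<close>
    moreover have "(\<lambda>i. inv (f j) \<otimes> f i) ` {i \<in> I. c i = e} \<subseteq> A"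
    proof safe
      fix i assume i: "i \<in> I" "e = c i"
      have eG: "e \<in> carrier G" using G i by blast
      have inv_act: "d (\<phi> (inv (f j) \<otimes> f i) u) u = d (\<phi> (f i) u) (\<phi> (f j) u)" if "u \<in> X" for u
        using dist_act_act[of "f j" "f i" u] G i(1) j(1) that by (simp add: commute)
      have "d (\<phi> (f i) x) (\<phi> (f j) x) \<le> d (\<phi> (f i) x) p + d p (\<phi> (f j) x)"
        using triangle fX i(1) j(1) pq by blast
      then have 1: "d (\<phi> (f i) x) (\<phi> (f j) x) \<le> 2 * D"
        using fp[OF i(1)] fp[OF j(1)] commute[of p "\<phi> (f i) x"] by linarith
      have "d (\<phi> (f i \<otimes> c i) x) (\<phi> (f j \<otimes> c j) x) \<le>
          d (\<phi> (f i \<otimes> c i) x) q + d q (\<phi> (f j \<otimes> c j) x)"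
        using triangle fX i(1) j(1) pq by blast
      then have "d (\<phi> (f i \<otimes> c i) x) (\<phi> (f j \<otimes> c j) x) \<le> 2 * D"
        using fq[OF i(1)] fq[OF j(1)] commute[of q "\<phi> (f i \<otimes> c i) x"] by linarith
      then have 2: "d (\<phi> (f i) (\<phi> e x)) (\<phi> (f j) (\<phi> e x)) \<le> 2 * D"
        using i j G x eG by (simp add: composition_rule)
      show "inv (f j) \<otimes> f i \<in> A"
        using 1 2 G i(1) j(1) x eG by (simp add: A_def inv_act act_closed)
    qed
    ultimately show ?thesis
      using card_inj_on_le[OF _ _ A(1)] A(2) order_trans by blast
  qed
  have "I = (\<Union>e\<in>B. {i \<in> I. c i = e})"
    using cH c_bounds(1) by (auto simp: B_def)
  moreover have "card (\<Union>e\<in>B. {i \<in> I. c i = e}) \<le> (\<Sum>e\<in>B. card {i \<in> I. c i = e})"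
    using fin by (intro card_UN_le) (simp add: B_def)
  moreover have "(\<Sum>e\<in>B. card {i \<in> I. c i = e}) \<le> card B * M"
    using sum_bounded_above[of B "\<lambda>e. card {i \<in> I. c i = e}" M] fibre by simp
  ultimately show ?thesis unfolding B_def by simp
qed

lemma infinite_conjugate_intersection_bounded:
  "\<exists>b. \<forall>n. infinite_conjugate_intersection G H n \<longrightarrow> n \<le> b"
proof -
  obtain S x where S: "finite_generating_set G H S" and x: "x \<in> X"
    and qi: "quasi_isometric_embedding H (word_metric G S) X d (\<lambda>h. \<phi> h x)"
    using qi_embedded unfolding qi_embedded_by_action_def by blast
  obtain \<delta> where sl: "slim \<delta>" using ex_slim by blast
  obtain Q where Q: "\<And>f h p. \<lbrakk>f \<in> carrier G; h \<in> H; p \<in> metric_interval (\<phi> f x) (\<phi> (f \<otimes> h) x)\<rbrakk>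
      \<Longrightarrow> \<exists>h'\<in>H. d p (\<phi> (f \<otimes> h') x) \<le> Q"
    using orbit_quasiconvex[OF S x qi] by blast
  have fin: "finite {h \<in> H. d x (\<phi> h x) \<le> T}" for T
    by (rule orbit_ball_finite[OF S x qi])
  define D where "D = 2 * \<delta> + Q"
  \<comment> \<open>Quasi-convexity at the degenerate interval yields a point within
    \<open>Q\<close> of \<open>x\<close>, hence \<open>Q \<ge> 0\<close>.\<close>
  have "x \<in> metric_interval (\<phi> \<one> x) (\<phi> (\<one> \<otimes> \<one>) x)"
    using x by (simp add: act_one metric_interval_ends)
  then obtain h where "d x (\<phi> (\<one> \<otimes> h) x) \<le> Q"
    using Q[OF mem_carrier[OF one_closed] one_closed] by blast
  then have "Q \<ge> 0" using nonneg order_trans by blast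
  then have D: "D \<ge> 0" using slim_nonneg[OF sl] by (simp add: D_def)
  have "acylindrical_along G d \<phi> ((\<lambda>h. \<phi> h x) ` H)"
    using acylindrical acylindrical_along_orbit[OF subset x]
    unfolding acylindrical_along_subgroup_def by blast
  then obtain R and M :: nat where R: "R > 0"
    and M: "\<And>u v. \<lbrakk>u \<in> (\<lambda>h. \<phi> h x) ` H; v \<in> (\<lambda>h. \<phi> h x) ` H; d u v \<ge> R\<rbrakk> \<Longrightarrow>
      finite {f \<in> carrier G. d (\<phi> f u) u \<le> 2 * D \<and> d (\<phi> f v) v \<le> 2 * D} \<and>
      card {f \<in> carrier G. d (\<phi> f u) u \<le> 2 * D \<and> d (\<phi> f v) v \<le> 2 * D} \<le> M"
    by (rule acylindrical_alongE[of _ _ _ _ "2 * D"]) (use D in simp, blast)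
  \<comment> \<open>The elements \<open>c\<close> that arise move \<open>x\<close> by at least
    \<open>L - 2 * D\<close>, which is the threshold \<open>R\<close> of acylindricity for
    displacement \<open>2 * D\<close>.\<close>
  define L where "L = R + 2 * D"
  define b where "b = card {h \<in> H. d x (\<phi> h x) \<le> L + 2 * D} * M"
  have "L \<ge> 0" using R D by (simp add: L_def)
  have x_orbit: "x \<in> (\<lambda>h. \<phi> h x) ` H"
    using x act_one one_closed by (metis image_eqI)
  have "n \<le> b" if n: "infinite_conjugate_intersection G H n" for n
  proof (cases "n = 0")
    case False
    obtain g where g: "\<And>i. i \<in> {1..n} \<Longrightarrow> g i \<in> carrier G"
      and inj: "inj_on (\<lambda>i. g i <# H) {1..n}"
      and inf: "infinite (\<Inter>i\<in>{1..n}. g i <# H #> inv (g i))"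
      using n unfolding infinite_conjugate_intersection_def by blast
    have ne: "{1..n} \<noteq> {}" using False by auto
    have "\<exists>p\<in>X. \<exists>q\<in>X. d p q = L \<and> (\<forall>i\<in>{1..n}. \<exists>a\<in>H. \<exists>b\<in>H.
        d p (\<phi> (g i \<otimes> a) x) \<le> D \<and> d q (\<phi> (g i \<otimes> b) x) \<le> D)"
      unfolding D_def
    proof (rule conjugates_near_common_pair[OF sl x \<open>L \<ge> 0\<close> _ fin _ ne g inf])
      show "\<exists>h'\<in>H. d p (\<phi> (f \<otimes> h') x) \<le> Q"
        if "f \<in> carrier G" "h \<in> H" "p \<in> metric_interval (\<phi> f x) (\<phi> (f \<otimes> h) x)" for f h p
        by (rule Q[OF that])
    qed auto
    then obtain p q where pq: "p \<in> X" "q \<in> X" "d p q = L"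
      and near: "\<And>i. i \<in> {1..n} \<Longrightarrow>
        \<exists>a\<in>H. \<exists>b\<in>H. d p (\<phi> (g i \<otimes> a) x) \<le> D \<and> d q (\<phi> (g i \<otimes> b) x) \<le> D"
      by blast
    have "card {1..n} \<le> b"
      unfolding b_def
    proof (rule card_cosets_near_pair_le[OF x D fin _ pq _ g inj near])
      fix c assume c: "c \<in> H" "d x (\<phi> c x) \<ge> L - 2 * D"
      show "finite {f \<in> carrier G. d (\<phi> f x) x \<le> 2 * D \<and> d (\<phi> f (\<phi> c x)) (\<phi> c x) \<le> 2 * D} \<and>
        card {f \<in> carrier G. d (\<phi> f x) x \<le> 2 * D \<and> d (\<phi> f (\<phi> c x)) (\<phi> c x) \<le> 2 * D} \<le> M"
        using M[OF x_orbit, of "\<phi> c x"] c by (simp add: L_def)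
    qed auto
    then show ?thesis by simp
  qed simp
  then show ?thesis by blast
qed

end

theorem proposition4p11:
  fixes G :: "('a, 'm) monoid_scheme"
    and X :: "'b set"
    and d :: "'b \<Rightarrow> 'b \<Rightarrow> real"
    and \<phi> :: "'a \<Rightarrow> 'b \<Rightarrow> 'b"
    and H :: "'a set"
  assumes "AQI_triple G X d \<phi> H"
  shows "height G H < \<infinity>"
proof -
  interpret AQI_triple G X d \<phi> H by fact
  let ?P = "infinite_conjugate_intersection G H"
  obtain b where b: "\<And>n. ?P n \<Longrightarrow> n \<le> b"
    using infinite_conjugate_intersection_bounded by blast
  \<comment> \<open>For \<open>n = 0\<close> the empty intersection is the whole type, infinite
    because \<open>H\<close> is. So \<open>?P 0\<close> holds and the greatest \<open>n\<close> with
    \<open>?P n\<close> exists.\<close>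
  have "infinite (UNIV :: 'a set)"
    by (rule infinite_super[OF subset_UNIV infinite])
  then have "?P 0" by (simp add: infinite_conjugate_intersection_def)
  then have "?P (GREATEST n. ?P n)" "\<And>m. ?P m \<Longrightarrow> m \<le> (GREATEST n. ?P n)"
    using GreatestI_nat[of ?P 0 b] Greatest_le_nat[of ?P _ b] b by auto
  then have "\<exists>n. ?P n \<and> (\<forall>m. ?P m \<longrightarrow> m \<le> n)" by blast
  then show ?thesis using infinite by (simp add: height_def)
qed

end
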